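(* Let $d\ge2$, let $\phi:\mathbb{R}^d\to[0,\infty)$ be an arbitrary non-negative continuous function and let $\xi$ be a centered $d$-dimensional random vector with $\xi\in B(\phi)$, $0<\|\xi\|B(\phi)<\infty$. Then for every $r=(r(1),\dots,r(d))$ with all $r(j)>0$, $$|\xi|_{r}\le e^{-1}\cdot2^{d/|r|}\cdot\prod_{j=1}^dr(j)^{r(j)/|r|}\cdot e^{-\Phi^*(r)/|r|}\cdot\|\xi\|B(\phi).$$
   Context: For $r=(r(1),\dots,r(d))$ with positive coordinates, $|r|=\sum_jr(j)$, and $|\xi|_r=\Big(\mathbf{E}\prod_{j=1}^d|\xi(j)|^{r(j)}\Big)^{1/|r|}$. A centered (mean zero) random vector $\xi$ belongs to $B(\phi)$ if there is $\tau\ge0$ such that $\max_{\epsilon\in\{-1,1\}^d}\mathbf{E}\exp\big(\sum_{j}\epsilon(j)\lambda(j)\xi(j)\big)\le\exp[\phi(\tau\lambda)]$ for all $\lambda\in\mathbb{R}^d$; $\|\xi\|B(\phi)$ is the infimum of all such $\tau>0$. $\Phi(\mu)=\phi(e^{\mu(1)},\dots,e^{\mu(d)})$ for $\mu\in\mathbb{R}^d$, and $\Phi^*(r)=\sup_{\mu\in\mathbb{R}^d}[(r,\mu)-\Phi(\mu)]$ (with $e^{-\infty}=0$). *)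

theory Defs
  imports "HOL-Probability.Probability"
begin

text \<open>
  Random vectors are functions into \<^typ>\<open>real ^ 'n\<close>, so \<open>d = CARD('n)\<close>.
  Moments and exponential moments are taken as nonnegative integrals with values in
  \<^typ>\<open>ennreal\<close>: bounding such a moment by a finite quantity then entails integrability,
  whereas the Bochner integral of a non-integrable function is \<open>0\<close>.
\<close>

text \<open>Intended for positive exponents only (hence \<open>\<infinity>\<close> is sent to \<open>\<infinity>\<close>).\<close>

definition ennpowr :: "ennreal \<Rightarrow> real \<Rightarrow> ennreal" where
  "ennpowr x p = (if x = \<infinity> then \<infinity> else ennreal (enn2real x powr p))"

definition eexp :: "ereal \<Rightarrow> ennreal" where
  "eexp x = (case x of ereal t \<Rightarrow> ennreal (exp t) | PInfty \<Rightarrow> \<infinity> | MInfty \<Rightarrow> 0)"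

definition weight :: "real ^ 'n \<Rightarrow> real" where
  "weight r = (\<Sum>j\<in>UNIV. r $ j)"

definition mixed_moment_norm :: "'a measure \<Rightarrow> real ^ 'n \<Rightarrow> ('a \<Rightarrow> real ^ 'n) \<Rightarrow> ennreal" where
  "mixed_moment_norm M r \<xi> =
     ennpowr (\<integral>\<^sup>+ \<omega>. ennreal (\<Prod>j\<in>UNIV. \<bar>\<xi> \<omega> $ j\<bar> powr (r $ j)) \<partial>M) (1 / weight r)"

definition centered_random_vector :: "'a measure \<Rightarrow> ('a \<Rightarrow> real ^ 'n) \<Rightarrow> bool" where
  "centered_random_vector M \<xi> \<longleftrightarrow>
     \<xi> \<in> borel_measurable M \<and> integrable M \<xi> \<and> integral\<^sup>L M \<xi> = 0"

definition sign_vectors :: "(real ^ 'n) set" where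
  "sign_vectors = {\<epsilon>. \<forall>j. \<epsilon> $ j \<in> {-1, 1}}"

lemma finite_sign_vectors: "finite (sign_vectors :: (real ^ 'n) set)"
proof -
  have "(sign_vectors :: (real ^ 'n) set) \<subseteq> vec_lambda ` (UNIV \<rightarrow>\<^sub>E {-1, 1})"
  proof
    fix \<epsilon> :: "real ^ 'n" assume "\<epsilon> \<in> sign_vectors"
    then have "vec_nth \<epsilon> \<in> UNIV \<rightarrow>\<^sub>E {-1, 1}"
      by (auto simp: sign_vectors_def)
    then show "\<epsilon> \<in> vec_lambda ` (UNIV \<rightarrow>\<^sub>E {-1, 1})"
      by (metis imageI vec_nth_inverse)
  qed
  then show ?thesis
    by (rule finite_subset) (intro finite_imageI finite_PiE; simp)
qed

definition B_bound :: "'a measure \<Rightarrow> (real ^ 'n \<Rightarrow> real) \<Rightarrow> ('a \<Rightarrow> real ^ 'n) \<Rightarrow> real \<Rightarrow> bool" where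
  "B_bound M \<phi> \<xi> \<tau> \<longleftrightarrow>
     (\<forall>l :: real ^ 'n.
        (MAX \<epsilon>\<in>sign_vectors. \<integral>\<^sup>+ \<omega>. ennreal (exp (\<Sum>j\<in>UNIV. \<epsilon> $ j * l $ j * \<xi> \<omega> $ j)) \<partial>M)
          \<le> ennreal (exp (\<phi> (\<tau> *\<^sub>R l))))"

definition B_space :: "'a measure \<Rightarrow> (real ^ 'n \<Rightarrow> real) \<Rightarrow> ('a \<Rightarrow> real ^ 'n) set" where
  "B_space M \<phi> = {\<xi>. centered_random_vector M \<xi> \<and> (\<exists>\<tau>\<ge>0. B_bound M \<phi> \<xi> \<tau>)}"

text \<open>The infimum is over strictly positive \<open>\<tau>\<close> and equals \<open>\<infinity>\<close> if there is none.\<close>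

definition B_norm :: "'a measure \<Rightarrow> (real ^ 'n \<Rightarrow> real) \<Rightarrow> ('a \<Rightarrow> real ^ 'n) \<Rightarrow> ennreal" where
  "B_norm M \<phi> \<xi> = Inf {ennreal \<tau> | \<tau>. \<tau> > 0 \<and> B_bound M \<phi> \<xi> \<tau>}"

definition exp_transform :: "(real ^ 'n \<Rightarrow> real) \<Rightarrow> real ^ 'n \<Rightarrow> real" where
  "exp_transform \<phi> \<mu> = \<phi> (\<chi> j. exp (\<mu> $ j))"

definition conjugate :: "(real ^ 'n \<Rightarrow> real) \<Rightarrow> real ^ 'n \<Rightarrow> ereal" where
  "conjugate f r = (SUP \<mu>. ereal (r \<bullet> \<mu> - f \<mu>))"

end

theory Submission
  imports Defs
begin

text \<open>
  For \<open>l\<^sub>j > 0\<close> the inequality \<open>y powr r \<le> (r / (e l)) powr r * exp (l y)\<close>, multiplied over the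
  coordinates, bounds the mixed moment by \<open>E exp (\<Sum> l\<^sub>j \<bar>\<xi>\<^sub>j\<bar>)\<close>, which is at most the
  sum over all \<open>2 ^ d\<close> sign vectors of the exponential moments controlled by \<open>\<phi> (\<tau> l)\<close>.
  Substituting \<open>\<tau> l\<^sub>j = exp \<mu>\<^sub>j\<close>, taking roots and optimising over \<open>\<mu>\<close> and \<open>\<tau>\<close> gives the claim.
\<close>

text \<open>The tangent inequality \<open>ln t \<le> t - 1\<close> at \<open>t = l * y / r\<close>,
  multiplied by \<open>r\<close> and exponentiated. Equality holds at \<open>y = r / l\<close>, so
  the constant is the maximum of \<open>y powr r * exp (- l * y)\<close>.\<close>

lemma powr_le_exp:
  fixes y r l :: real
  assumes "y \<ge> 0" "r > 0" "l > 0"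
  shows "y powr r \<le> (r * exp (- 1) / l) powr r * exp (l * y)"
proof (cases "y = 0")
  case False
  with assms have y: "y > 0" by simp
  have "ln (l * y / r) \<le> l * y / r - 1"
    using y assms by (intro ln_le_minus_one) simp
  then have "r * ln (l * y / r) \<le> r * (l * y / r - 1)"
    using assms by (intro mult_left_mono) auto
  then have "r * ln y \<le> r * (ln r - 1 - ln l) + l * y"
    using y assms by (simp add: ln_div ln_mult algebra_simps)
  then have "exp (r * ln y) \<le> exp (r * (ln r - 1 - ln l) + l * y)"
    by simp
  then show ?thesis
    using y assms by (simp add: powr_def exp_add ln_div ln_mult)
qed simp

text \<open>Source of the factor \<open>2 ^ CARD('n)\<close>, whose root becomes
  \<open>2 powr (real CARD('n) / weight r)\<close> in the theorem.\<close>

lemma card_sign_vectors_le: "card (sign_vectors :: (real ^ 'n) set) \<le> 2 ^ CARD('n)"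
proof -
  let ?F = "(UNIV :: 'n set) \<rightarrow>\<^sub>E {-1, 1 :: real}"
  have "(sign_vectors :: (real ^ 'n) set) \<subseteq> vec_lambda ` ?F"
  proof
    fix \<epsilon> :: "real ^ 'n" assume "\<epsilon> \<in> sign_vectors"
    then have "vec_nth \<epsilon> \<in> ?F"
      by (auto simp: sign_vectors_def)
    then show "\<epsilon> \<in> vec_lambda ` ?F"
      by (metis imageI vec_nth_inverse)
  qed
  moreover have fin: "finite ?F"
    by (intro finite_PiE) auto
  ultimately have "card (sign_vectors :: (real ^ 'n) set) \<le> card (vec_lambda ` ?F :: (real ^ 'n) set)"
    by (intro card_mono finite_imageI)
  also have "\<dots> \<le> card ?F"
    using fin by (rule card_image_le)
  also have "\<dots> = 2 ^ CARD('n)"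
    by (simp add: card_PiE card_insert_if numeral_2_eq_2)
  finally show ?thesis .
qed

text \<open>The sign pattern of \<open>x\<close> turns one summand on the right into the left side,
  and the other summands are positive.\<close>

lemma exp_sum_abs_le:
  fixes l x :: "real ^ 'n"
  shows "exp (\<Sum>j\<in>UNIV. l $ j * \<bar>x $ j\<bar>)
    \<le> (\<Sum>\<epsilon>\<in>sign_vectors. exp (\<Sum>j\<in>UNIV. \<epsilon> $ j * l $ j * x $ j))"
proof -
  \<comment> \<open>Zero coordinates get the sign 1, since \<open>sgn\<close> would give 0 there and
    leave \<open>sign_vectors\<close>.\<close>
  define s :: "real ^ 'n" where "s = (\<chi> j. if x $ j < 0 then - 1 else 1)"
  have "s \<in> sign_vectors"
    by (simp add: sign_vectors_def s_def)
  moreover have "(\<Sum>j\<in>UNIV. l $ j * \<bar>x $ j\<bar>) = (\<Sum>j\<in>UNIV. s $ j * l $ j * x $ j)"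
    by (intro sum.cong) (auto simp: s_def)
  ultimately show ?thesis
    using member_le_sum[of s sign_vectors "\<lambda>\<epsilon>. exp (\<Sum>j\<in>UNIV. \<epsilon> $ j * l $ j * x $ j)"]
    by (simp add: finite_sign_vectors)
qed

text \<open>The maximum in \<open>B_bound\<close> dominates the exponential moment of each sign
  vector; these moments are then added up.\<close>

lemma nn_integral_exp_sum_abs_le:
  fixes l :: "real ^ 'n" and \<xi> :: "'a \<Rightarrow> real ^ 'n"
  assumes [measurable]: "\<xi> \<in> borel_measurable M" and B: "B_bound M \<phi> \<xi> \<tau>"
  shows "(\<integral>\<^sup>+ \<omega>. ennreal (exp (\<Sum>j\<in>UNIV. l $ j * \<bar>\<xi> \<omega> $ j\<bar>)) \<partial>M)
    \<le> ennreal (2 ^ CARD('n) * exp (\<phi> (\<tau> *\<^sub>R l)))"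
proof -
  let ?I = "\<lambda>\<epsilon> :: real ^ 'n. \<integral>\<^sup>+ \<omega>. ennreal (exp (\<Sum>j\<in>UNIV. \<epsilon> $ j * l $ j * \<xi> \<omega> $ j)) \<partial>M"
  have [measurable]: "(\<lambda>\<omega>. \<xi> \<omega> $ j) \<in> borel_measurable M" for j
    using measurable_compose[OF assms(1), of "\<lambda>v. v $ j" borel]
    by (simp add: borel_measurable_continuous_onI continuous_on_component)
  have I: "?I \<epsilon> \<le> ennreal (exp (\<phi> (\<tau> *\<^sub>R l)))" if "\<epsilon> \<in> sign_vectors" for \<epsilon>
  proof -
    have "?I \<epsilon> \<le> (MAX \<epsilon>\<in>sign_vectors. ?I \<epsilon>)"
      using that by (intro Max_ge finite_imageI finite_sign_vectors imageI)
    also have "\<dots> \<le> ennreal (exp (\<phi> (\<tau> *\<^sub>R l)))"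
      using B by (auto simp: B_bound_def)
    finally show ?thesis .
  qed
  have "(\<integral>\<^sup>+ \<omega>. ennreal (exp (\<Sum>j\<in>UNIV. l $ j * \<bar>\<xi> \<omega> $ j\<bar>)) \<partial>M)
      \<le> (\<integral>\<^sup>+ \<omega>. (\<Sum>\<epsilon>\<in>sign_vectors. ennreal (exp (\<Sum>j\<in>UNIV. \<epsilon> $ j * l $ j * \<xi> \<omega> $ j))) \<partial>M)"
    by (intro nn_integral_mono) (simp add: sum_ennreal ennreal_leI[OF exp_sum_abs_le])
  also have "\<dots> = (\<Sum>\<epsilon>\<in>sign_vectors. ?I \<epsilon>)"
    by (intro nn_integral_sum) measurable
  also have "\<dots> \<le> (\<Sum>\<epsilon>\<in>(sign_vectors :: (real ^ 'n) set). ennreal (exp (\<phi> (\<tau> *\<^sub>R l))))"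
    by (intro sum_mono I)
  also have "\<dots> = ennreal (real (card (sign_vectors :: (real ^ 'n) set)) * exp (\<phi> (\<tau> *\<^sub>R l)))"
    by (simp add: ennreal_mult ennreal_of_nat_eq_real_of_nat)
  also have "\<dots> \<le> ennreal (2 ^ CARD('n) * exp (\<phi> (\<tau> *\<^sub>R l)))"
  proof (intro ennreal_leI mult_right_mono)
    show "real (card (sign_vectors :: (real ^ 'n) set)) \<le> 2 ^ CARD('n)"
      using of_nat_mono[OF card_sign_vectors_le[where 'n='n], where 'a=real] by simp
  qed simp
  finally show ?thesis .
qed

lemma mixed_moment_le:
  fixes r \<mu> :: "real ^ 'n" and \<xi> :: "'a \<Rightarrow> real ^ 'n"
  assumes [measurable]: "\<xi> \<in> borel_measurable M" and B: "B_bound M \<phi> \<xi> \<tau>"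
    and \<tau>: "\<tau> > 0" and r: "\<And>j. r $ j > 0"
  shows "(\<integral>\<^sup>+ \<omega>. ennreal (\<Prod>j\<in>UNIV. \<bar>\<xi> \<omega> $ j\<bar> powr (r $ j)) \<partial>M)
    \<le> ennreal ((\<Prod>j\<in>UNIV. (r $ j * exp (- 1) / (exp (\<mu> $ j) / \<tau>)) powr (r $ j))
                * (2 ^ CARD('n) * exp (exp_transform \<phi> \<mu>)))"
proof -
  \<comment> \<open>This choice makes every coordinate positive, as \<open>powr_le_exp\<close>
    requires, and turns \<open>\<tau> *\<^sub>R l\<close> into the argument at which
    \<open>exp_transform\<close> evaluates \<open>\<phi>\<close>.\<close>
  define l :: "real ^ 'n" where "l = (\<chi> j. exp (\<mu> $ j) / \<tau>)"
  have l: "l $ j > 0" for j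
    using \<tau> by (simp add: l_def)
  let ?K = "\<Prod>j\<in>UNIV. (r $ j * exp (- 1) / l $ j) powr (r $ j)"
  let ?E = "\<lambda>\<omega>. exp (\<Sum>j\<in>UNIV. l $ j * \<bar>\<xi> \<omega> $ j\<bar>)"
  have K: "?K \<ge> 0"
    by (intro prod_nonneg) simp
  have [measurable]: "(\<lambda>\<omega>. \<xi> \<omega> $ j) \<in> borel_measurable M" for j
    using measurable_compose[OF assms(1), of "\<lambda>v. v $ j" borel]
    by (simp add: borel_measurable_continuous_onI continuous_on_component)
  have "(\<Prod>j\<in>UNIV. \<bar>\<xi> \<omega> $ j\<bar> powr (r $ j)) \<le> ?K * ?E \<omega>" for \<omega>
  proof -
    have "(\<Prod>j\<in>UNIV. \<bar>\<xi> \<omega> $ j\<bar> powr (r $ j))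
        \<le> (\<Prod>j\<in>UNIV. (r $ j * exp (- 1) / l $ j) powr (r $ j) * exp (l $ j * \<bar>\<xi> \<omega> $ j\<bar>))"
      by (intro prod_mono conjI powr_le_exp r l) auto
    then show ?thesis
      by (simp add: prod.distrib exp_sum)
  qed
  then have "(\<integral>\<^sup>+ \<omega>. ennreal (\<Prod>j\<in>UNIV. \<bar>\<xi> \<omega> $ j\<bar> powr (r $ j)) \<partial>M)
      \<le> (\<integral>\<^sup>+ \<omega>. ennreal ?K * ennreal (?E \<omega>) \<partial>M)"
    using K by (intro nn_integral_mono) (simp add: ennreal_mult[symmetric] ennreal_leI)
  also have "\<dots> = ennreal ?K * (\<integral>\<^sup>+ \<omega>. ennreal (?E \<omega>) \<partial>M)"
    by (intro nn_integral_cmult) measurable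
  also have "\<dots> \<le> ennreal ?K * ennreal (2 ^ CARD('n) * exp (\<phi> (\<tau> *\<^sub>R l)))"
    by (intro mult_left_mono nn_integral_exp_sum_abs_le[OF _ B]) auto
  also have "\<dots> = ennreal (?K * (2 ^ CARD('n) * exp (\<phi> (\<tau> *\<^sub>R l))))"
    using K by (simp add: ennreal_mult)
  also have "\<tau> *\<^sub>R l = (\<chi> j. exp (\<mu> $ j))"
    using \<tau> by (simp add: vec_eq_iff l_def)
  finally show ?thesis
    by (simp add: l_def exp_transform_def)
qed

lemma weight_pos:
  fixes r :: "real ^ 'n"
  assumes "\<And>j. r $ j > 0"
  shows "weight r > 0"
  unfolding weight_def using assms by (intro sum_pos) auto

text \<open>Both sides are written as a single exponential. Since the exponents \<open>r $ j\<close>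
  add up to \<open>weight r\<close>, the root leaves exactly one factor \<open>\<tau>\<close> and
  one factor \<open>exp (- 1)\<close>. The number \<open>p\<close> stands for the value of
  \<open>exp_transform \<phi>\<close> at \<open>\<mu>\<close>.\<close>

lemma root_of_moment_bound:
  fixes r \<mu> :: "real ^ 'n"
  assumes \<tau>: "\<tau> > 0" and r: "\<And>j. r $ j > 0"
  shows "((\<Prod>j\<in>UNIV. (r $ j * exp (- 1) / (exp (\<mu> $ j) / \<tau>)) powr (r $ j))
            * (2 ^ CARD('n) * exp p)) powr (1 / weight r)
    = exp (- 1) * 2 powr (real CARD('n) / weight r)
        * (\<Prod>j\<in>UNIV. (r $ j) powr (r $ j / weight r)) * exp (- (r \<bullet> \<mu> - p) / weight r) * \<tau>"
    (is "?L powr _ = ?R")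
proof -
  define w where "w = weight r"
  have w: "w > 0"
    unfolding w_def using r by (rule weight_pos)
  have sw: "(\<Sum>j\<in>UNIV. r $ j) = w"
    by (simp add: w_def weight_def)
  let ?S = "\<Sum>j\<in>UNIV. r $ j * ln (r $ j)"
  have "(r $ j * exp (- 1) / (exp (\<mu> $ j) / \<tau>)) powr (r $ j)
      = exp (r $ j * ln (r $ j) - r $ j + r $ j * ln \<tau> - r $ j * \<mu> $ j)" for j
    using r[of j] \<tau> by (simp add: powr_def ln_div ln_mult algebra_simps)
  then have "(\<Prod>j\<in>UNIV. (r $ j * exp (- 1) / (exp (\<mu> $ j) / \<tau>)) powr (r $ j))
      = exp (?S - w + w * ln \<tau> - r \<bullet> \<mu>)"
    by (simp add: exp_sum[symmetric] sum.distrib sum_subtractf inner_vec_def sw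
        sum_distrib_right[symmetric])
  moreover have two: "(2::real) ^ CARD('n) = exp (real CARD('n) * ln 2)"
    by (simp add: exp_of_nat_mult)
  ultimately have L: "?L = exp (?S - w + w * ln \<tau> - r \<bullet> \<mu> + (real CARD('n) * ln 2 + p))"
    by (simp only: exp_add)
  have "(\<Prod>j\<in>UNIV. (r $ j) powr (r $ j / w)) = exp (?S / w)"
    using r by (simp add: powr_def exp_sum less_imp_neq[symmetric] sum_divide_distrib)
  then have "?R = exp (- 1 + real CARD('n) / w * ln 2 + ?S / w + - (r \<bullet> \<mu> - p) / w + ln \<tau>)"
    using \<tau> unfolding exp_add w_def[symmetric] by (simp add: powr_def)
  also have "\<dots> = exp ((?S - w + w * ln \<tau> - r \<bullet> \<mu> + (real CARD('n) * ln 2 + p)) * (1 / w))"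
    using w by (simp add: field_simps)
  also have "\<dots> = ?L powr (1 / w)"
    unfolding L by (simp add: powr_def)
  finally show ?thesis
    by (simp add: w_def)
qed

text \<open>A finite bound excludes the infinite branch of \<open>ennpowr\<close>, so monotonicity
  of the real power applies.\<close>

lemma ennpowr_mono:
  assumes "x \<le> ennreal a" "a \<ge> 0" "p \<ge> 0"
  shows "ennpowr x p \<le> ennreal (a powr p)"
proof -
  have "x \<noteq> \<infinity>"
    using assms(1) by (auto simp: top_unique)
  moreover have "enn2real x \<le> a"
    using assms by (metis enn2real_leI)
  ultimately show ?thesis
    using assms by (auto simp: ennpowr_def intro!: ennreal_leI powr_mono2)
qed

text \<open>The quotient \<open>m / k\<close> is a lower bound of all admissible
  \<open>\<tau>\<close>, hence of their infimum, whether or not the infimum is attained.\<close>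

lemma le_mult_B_norm:
  assumes "B_norm M \<phi> \<xi> = ennreal b" "k > 0" "b \<ge> 0"
    and "\<And>\<tau>. \<tau> > 0 \<Longrightarrow> B_bound M \<phi> \<xi> \<tau> \<Longrightarrow> m \<le> k * \<tau>"
  shows "m \<le> k * b"
proof -
  have "ennreal (m / k) \<le> B_norm M \<phi> \<xi>"
    unfolding B_norm_def using assms(2,4)
    by (intro Inf_greatest) (auto intro!: ennreal_leI simp: divide_le_eq mult.commute)
  then have "m / k \<le> b"
    using assms by (simp add: ennreal_le_iff)
  then show ?thesis
    using assms(2) by (simp add: divide_le_eq mult.commute)
qed

text \<open>After taking logarithms the assumption says that \<open>w * ln (a / m)\<close> bounds
  every \<open>r \<bullet> \<mu> - f \<mu>\<close>, hence also their supremum, the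
  conjugate.\<close>

lemma le_mult_eexp_conjugate:
  fixes f :: "real ^ 'n \<Rightarrow> real"
  assumes w: "w > 0" and a: "a \<ge> 0" and m: "m \<ge> 0"
    and le: "\<And>\<mu>. m \<le> a * exp (- (r \<bullet> \<mu> - f \<mu>) / w)"
  shows "ennreal m \<le> ennreal a * eexp (- conjugate f r / ereal w)"
\<comment> \<open>The logarithm needs \<open>m > 0\<close>. An infinite conjugate can occur only for
  \<open>m = 0\<close>, where the claim is trivial.\<close>
proof (cases "m = 0")
  case False
  with m have m0: "m > 0" by simp
  have a0: "a > 0"
    using le[of 0] m0 a by (cases "a = 0") auto
  have bound: "r \<bullet> \<mu> - f \<mu> \<le> w * ln (a / m)" for \<mu>
  proof -
    have "ln m \<le> ln (a * exp (- (r \<bullet> \<mu> - f \<mu>) / w))"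
      using le[of \<mu>] m0 by simp
    also have "\<dots> = ln a - (r \<bullet> \<mu> - f \<mu>) / w"
      using a0 by (simp add: ln_mult diff_divide_distrib)
    finally show ?thesis
      using w m0 a0 by (simp add: ln_div field_simps)
  qed
  have up: "conjugate f r \<le> ereal (w * ln (a / m))"
    unfolding conjugate_def using bound by (intro SUP_least) simp
  \<comment> \<open>Any single \<open>\<mu>\<close> excludes the value minus infinity; together with
    \<open>up\<close> the conjugate is a real number.\<close>
  have "ereal (r \<bullet> 0 - f 0) \<le> conjugate f r"
    unfolding conjugate_def by (rule SUP_upper) simp
  with up obtain c where c: "conjugate f r = ereal c"
    by (cases "conjugate f r") auto
  have "c / w \<le> ln (a / m)"
    using up w by (simp add: c divide_le_eq mult.commute)
  then have "exp (c / w) \<le> a / m"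
    using a0 m0 by (metis exp_le_cancel_iff exp_ln divide_pos_pos)
  then have "m \<le> a * exp (- c / w)"
    using m0 by (simp add: exp_minus field_simps)
  then show ?thesis
    using w a by (simp add: c eexp_def ennreal_mult[symmetric] ennreal_leI)
qed simp

theorem proposition7p2:
  fixes M :: "'a measure"
    and \<phi> :: "real ^ 'n \<Rightarrow> real"
    and \<xi> :: "'a \<Rightarrow> real ^ 'n"
    and r :: "real ^ 'n"
  assumes "CARD('n) \<ge> 2"
    and "prob_space M"
    and "continuous_on UNIV \<phi>"
    and "\<And>x. \<phi> x \<ge> 0"
    and "centered_random_vector M \<xi>"
    and "\<xi> \<in> B_space M \<phi>"
    and "0 < B_norm M \<phi> \<xi>" and "B_norm M \<phi> \<xi> < \<infinity>"
    and "\<And>j. r $ j > 0"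
  shows "mixed_moment_norm M r \<xi>
    \<le> ennreal (exp (- 1) * 2 powr (real CARD('n) / weight r)
                 * (\<Prod>j\<in>UNIV. (r $ j) powr (r $ j / weight r)))
      * eexp (- conjugate (exp_transform \<phi>) r / ereal (weight r))
      * B_norm M \<phi> \<xi>"
proof -
  define w where "w = weight r"
  define C where "C = exp (- 1) * 2 powr (real CARD('n) / w) * (\<Prod>j\<in>UNIV. (r $ j) powr (r $ j / w))"
  have w: "w > 0"
    unfolding w_def using assms(9) by (rule weight_pos)
  have C: "C > 0"
    unfolding C_def using assms(9) by (intro mult_pos_pos prod_pos) (auto simp: less_imp_neq[symmetric])
  have meas: "\<xi> \<in> borel_measurable M"
    using assms(5) by (simp add: centered_random_vector_def)
  obtain b where b: "b \<ge> 0" "B_norm M \<phi> \<xi> = ennreal b"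
    using assms(8) by (cases "B_norm M \<phi> \<xi>") auto
  have le: "mixed_moment_norm M r \<xi>
      \<le> ennreal (C * exp (- (r \<bullet> \<mu> - exp_transform \<phi> \<mu>) / w) * \<tau>)"
    if "\<tau> > 0" "B_bound M \<phi> \<xi> \<tau>" for \<mu> \<tau>
    \<comment> \<open>Read from right to left, \<open>root_of_moment_bound\<close> presents the
      bound as a root, so that \<open>ennpowr_mono\<close> reduces the claim to the moment
      itself.\<close>
    unfolding mixed_moment_norm_def C_def w_def root_of_moment_bound[OF that(1) assms(9), symmetric]
    using w[unfolded w_def]
    by (intro ennpowr_mono mixed_moment_le meas that assms(9)) (auto intro!: mult_nonneg_nonneg prod_nonneg)
  \<comment> \<open>The infimum of the empty set is infinite, so a finite norm provides an
    admissible \<open>\<tau>\<close>. One such \<open>\<tau>\<close> already makes the mixed moment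
    finite, and the remaining estimates can be made in the reals.\<close>
  have "{ennreal \<tau> | \<tau>. \<tau> > 0 \<and> B_bound M \<phi> \<xi> \<tau>} \<noteq> {}"
    using assms(8) unfolding B_norm_def by (metis Inf_empty infinity_ennreal_def less_irrefl)
  then obtain \<tau> where "\<tau> > 0" "B_bound M \<phi> \<xi> \<tau>"
    by blast
  from le[OF this] obtain m where m: "m \<ge> 0" "mixed_moment_norm M r \<xi> = ennreal m"
    by (cases "mixed_moment_norm M r \<xi>") (auto simp: top_unique)
  \<comment> \<open>The infimum over \<open>\<tau>\<close> is taken first, with \<open>\<mu>\<close>
    fixed; the resulting bound holds for all \<open>\<mu>\<close> and is then optimised through the
    conjugate.\<close>
  have "m \<le> C * exp (- (r \<bullet> \<mu> - exp_transform \<phi> \<mu>) / w) * b" for \<mu>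
  proof (rule le_mult_B_norm[OF b(2)])
    fix \<tau> assume "\<tau> > 0" "B_bound M \<phi> \<xi> \<tau>"
    with le[OF this, of \<mu>] C show "m \<le> C * exp (- (r \<bullet> \<mu> - exp_transform \<phi> \<mu>) / w) * \<tau>"
      by (simp add: m ennreal_le_iff)
  qed (use C b in auto)
  then have "ennreal m \<le> ennreal (C * b) * eexp (- conjugate (exp_transform \<phi>) r / ereal w)"
    using w C b m by (intro le_mult_eexp_conjugate) (auto simp: mult_ac)
  then show ?thesis
    unfolding w_def[symmetric] C_def[symmetric] using C b m by (simp add: ennreal_mult mult_ac)
qed

end
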